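(* Fix $h>0$ and run the method $x_{k+1}=x_k-h_k(g_k+e_k)$, $k=0,\dots,N-1$, with the constant schedule $h_k\equiv hR^2/(\varepsilon N)$ and uniform averaging $x_A=\frac1{N+1}\sum_{k=0}^Nx_k$. Then $$\mathcal E_N\;\ge\;\frac{(\sqrt{2h}-1)_+^2}{h^2}\cdot\frac{\varepsilon^2N}{2R^2s^2}\,\big(1+o(1)\big)$$ as $N\to\infty$ at fixed $h,\varepsilon,R,L,s,d$.
   Context: Fix a dimension $d\ge1$, $x_0\in\mathbb R^d$, constants $R,L,s>0$ and $\varepsilon\in(0,RL)$. Write $(x)_+=\max\{x,0\}$ and $(x)_+^2=((x)_+)^2$. Norms are Euclidean. Let $\mathcal C=\mathcal C(R,L)$ be the class of convex (possibly nonsmooth) functions $f:\mathbb R^d\to\mathbb R$ admitting a minimizer $x_\star$ with $\|x_0-x_\star\|\le R$ and such that $\|g\|\le L$ for every $x$ and every $g\in\partial f(x)$; write $f_\star=f(x_\star)$. For an instance $f$ the oracle uses a measurable selection $x\mapsto g(x)\in\partial f(x)$, and $g_k=g(x_k)$. With $\mathcal F_k=\sigma(\omega,e_0,\dots,e_{k-1})$ ($\omega$ denoting internal randomness of the algorithm, if any, drawn independently of the noise before the run), a law $P$ of the noise sequence is admissible if for all $k$, $\mathbb E_P[\exp\langle a,e_k\rangle\mid\mathcal F_k]\le\exp(s^2\|a\|^2/2)$ for all $a\in\mathbb R^d$. The failure exponent is $$\mathcal E_N=-\log\,\sup_f\ \sup_P\ \mathbb P_P\big(f(x_A)-f_\star\ge\varepsilon\big),$$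 the suprema running over all $f\in\mathcal C$ (together with all measurable subgradient selections of the oracle) and all admissible laws $P$. *)

theory Defs
  imports "HOL-Probability.Probability" "HOL-Library.Landau_Symbols"
begin

definition subdifferential :: "('a::euclidean_space \<Rightarrow> real) \<Rightarrow> 'a \<Rightarrow> 'a set" where
  "subdifferential f x = {g. \<forall>y. f y \<ge> f x + g \<bullet> (y - x)}"

definition objective_class :: "'a::euclidean_space \<Rightarrow> real \<Rightarrow> real \<Rightarrow> ('a \<Rightarrow> real) set" where
  "objective_class x0 R L = {f. convex_on UNIV f \<and>
     (\<exists>xs. is_arg_min f (\<lambda>_. True) xs \<and> norm (x0 - xs) \<le> R) \<and>
     (\<forall>x. \<forall>g\<in>subdifferential f x. norm g \<le> L)}"

definition oracle_instances ::
    "'a::euclidean_space \<Rightarrow> real \<Rightarrow> real \<Rightarrow> (('a \<Rightarrow> real) \<times> ('a \<Rightarrow> 'a)) set" where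
  "oracle_instances x0 R L = {(f, g). f \<in> objective_class x0 R L \<and>
     g \<in> borel_measurable borel \<and> (\<forall>x. g x \<in> subdifferential f x)}"

text \<open>
  A noise sequence is a point of \<^typ>\<open>nat \<Rightarrow> 'a\<close>, and its law is a probability measure on the
  product Borel sigma-algebra. The history below is the sigma-algebra generated by the first
  \<open>k\<close> coordinates; no internal randomness enters, since the methods considered are
  deterministic functions of the oracle and the noise.
\<close>

definition noise_history :: "nat \<Rightarrow> (nat \<Rightarrow> 'a::euclidean_space) measure" where
  "noise_history k = sigma UNIV {(\<lambda>e. e j) -` B |j B. j < k \<and> B \<in> sets borel}"

text \<open>
  The nonnegative conditional expectation is used because \<^const>\<open>real_cond_exp\<close> turns an
  infinite conditional expectation into 0, which would admit non-integrable exponential moments.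
\<close>

definition admissible_laws :: "real \<Rightarrow> (nat \<Rightarrow> 'a::euclidean_space) measure set" where
  "admissible_laws s = {P. prob_space P \<and> sets P = sets (\<Pi>\<^sub>M k\<in>UNIV. borel) \<and>
     (\<forall>k a. AE e in P.
        nn_cond_exp P (noise_history k) (\<lambda>e. ennreal (exp (a \<bullet> e k))) e
          \<le> ennreal (exp (s\<^sup>2 * (norm a)\<^sup>2 / 2)))}"

text \<open>
  \<^const>\<open>nn_cond_exp\<close> is 0 by convention unless its second argument is a sub-sigma-algebra;
  the following fact rules that case out.
\<close>

lemma subalgebra_noise_history:
  assumes "sets P = sets (\<Pi>\<^sub>M k\<in>UNIV. (borel :: 'a::euclidean_space measure))"
  shows "subalgebra P (noise_history k)"
proof -
  have sp: "space P = UNIV"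
    using sets_eq_imp_space_eq[OF assms] by (simp add: space_PiM)
  have "(\<lambda>e. e j) -` B \<in> sets P" if "B \<in> sets borel" for j and B :: "'a set"
  proof -
    have "(\<lambda>e. e j) \<in> measurable P borel"
      unfolding measurable_cong_sets[OF assms refl] by (rule measurable_component_singleton) simp
    from measurable_sets[OF this that] show ?thesis
      by (simp add: sp)
  qed
  then have "sigma_sets UNIV {(\<lambda>e. e j) -` B |j B. j < k \<and> B \<in> sets (borel :: 'a measure)} \<subseteq> sets P"
    using sets.sigma_sets_subset[of "{(\<lambda>e. e j) -` B |j B. j < k \<and> B \<in> sets (borel :: 'a measure)}" P]
    by (auto simp: sp)
  then show ?thesis
    by (simp add: subalgebra_def noise_history_def sp)
qed

text \<open>
  A method \<open>A\<close> maps an oracle \<open>g\<close> and a noise sequence \<open>e\<close> to its output point. The value at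
  \<^const>\<open>arg_min\<close> is the minimum of \<open>f\<close>, as a minimizer exists for every instance.
\<close>

definition worst_failure_prob ::
    "'a::euclidean_space \<Rightarrow> real \<Rightarrow> real \<Rightarrow> real \<Rightarrow> real \<Rightarrow>
     (('a \<Rightarrow> 'a) \<Rightarrow> (nat \<Rightarrow> 'a) \<Rightarrow> 'a) \<Rightarrow> ennreal" where
  "worst_failure_prob x0 R L s \<epsilon> A =
     (SUP (f, g) \<in> oracle_instances x0 R L. SUP P \<in> admissible_laws s.
        emeasure P {e \<in> space P. f (A g e) - f (ARG_MIN f x. True) \<ge> \<epsilon>})"

text \<open>
  The exponent is infinite if the worst-case failure probability vanishes.
\<close>

definition failure_exponent ::
    "'a::euclidean_space \<Rightarrow> real \<Rightarrow> real \<Rightarrow> real \<Rightarrow> real \<Rightarrow>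
     (('a \<Rightarrow> 'a) \<Rightarrow> (nat \<Rightarrow> 'a) \<Rightarrow> 'a) \<Rightarrow> ereal" where
  "failure_exponent x0 R L s \<epsilon> A =
     (let p = worst_failure_prob x0 R L s \<epsilon> A
      in if p = 0 then \<infinity> else ereal (- ln (enn2real p)))"

primrec sgd_iterate ::
    "'a::euclidean_space \<Rightarrow> (nat \<Rightarrow> real) \<Rightarrow> ('a \<Rightarrow> 'a) \<Rightarrow> (nat \<Rightarrow> 'a) \<Rightarrow> nat \<Rightarrow> 'a" where
  "sgd_iterate x0 \<eta> g e 0 = x0"
| "sgd_iterate x0 \<eta> g e (Suc k) =
     sgd_iterate x0 \<eta> g e k - \<eta> k *\<^sub>R (g (sgd_iterate x0 \<eta> g e k) + e k)"

definition sgd_average ::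
    "'a::euclidean_space \<Rightarrow> (nat \<Rightarrow> real) \<Rightarrow> nat \<Rightarrow> ('a \<Rightarrow> 'a) \<Rightarrow> (nat \<Rightarrow> 'a) \<Rightarrow> 'a" where
  "sgd_average x0 \<eta> N g e = (1 / real (N + 1)) *\<^sub>R (\<Sum>k=0..N. sgd_iterate x0 \<eta> g e k)"

end

theory Submission
  imports Defs
begin

text \<open>
  For a minimizer \<open>xs\<close> let \<open>Y k\<close> be the square root of
  \<open>\<kappa>\<^sup>2 + \<bar>x k - xs\<bar>\<^sup>2 + 2 \<eta> (\<Sum>j<k. g j \<bullet> (x j - xs))\<close>. Since \<open>\<bar>x k - xs\<bar> \<le> Y k\<close>, one step increases
  \<open>Y\<close> by at most \<open>-\<eta> (e k \<bullet> v)\<close> with \<open>\<bar>v\<bar> \<le> 1\<close>, up to an error of second order in \<open>\<eta>\<close>, so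
  \<open>exp (\<lambda> Y k)\<close> grows in expectation by a factor \<open>exp (\<lambda>\<^sup>2 \<eta>\<^sup>2 s\<^sup>2 / 2)\<close> with a negligible correction.
  An averaged gap of \<open>\<epsilon>\<close> forces \<open>Y N \<ge> R sqrt (2 h) - \<eta> L\<close>, whereas \<open>Y 0 \<le> R + \<kappa>\<close>. Markov's
  inequality with \<open>\<lambda> \<eta> = (sqrt (2 h) - 1) \<epsilon> / (h R s\<^sup>2)\<close> and \<open>\<kappa> = 1 / sqrt N\<close> gives the exponent
  with an error of order \<open>sqrt N\<close>.
\<close>

section \<open>Exponential moments of a conditionally sub-Gaussian vector\<close>

text \<open>The norm is at most the dimension times the largest absolute coordinate, and one of the
  two signs makes the matching exponential on the right dominate. This reduces exponential moments
  of the norm to linear exponentials, the only ones that the noise assumption controls.\<close>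

lemma exp_norm_le:
  fixes z :: "'a::euclidean_space" and c :: real
  assumes "c \<ge> 0"
  shows "exp (c * norm z) \<le> (\<Sum>b\<in>Basis. exp ((c * DIM('a)) *\<^sub>R b \<bullet> z) + exp ((- c * DIM('a)) *\<^sub>R b \<bullet> z))"
proof -
  have "Max ((\<lambda>i. \<bar>z \<bullet> i\<bar>) ` Basis) \<in> (\<lambda>i. \<bar>z \<bullet> i\<bar>) ` Basis"
    by (rule Max_in) auto
  then obtain b where b: "b \<in> Basis" and max: "\<bar>z \<bullet> b\<bar> = Max ((\<lambda>i. \<bar>z \<bullet> i\<bar>) ` Basis)"
    by (metis (no_types, lifting) imageE)
  have "\<bar>z \<bullet> i\<bar> \<le> \<bar>z \<bullet> b\<bar>" if "i \<in> Basis" for i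
    unfolding max using that by (intro Max_ge) auto
  then have "(\<Sum>i\<in>Basis. \<bar>z \<bullet> i\<bar>) \<le> DIM('a) * \<bar>z \<bullet> b\<bar>"
    by (rule sum_bounded_above)
  then have "norm z \<le> DIM('a) * \<bar>z \<bullet> b\<bar>"
    using norm_le_l1[of z] by linarith
  then have "c * norm z \<le> c * (DIM('a) * \<bar>z \<bullet> b\<bar>)"
    using assms by (rule mult_left_mono)
  then have "exp (c * norm z) \<le> exp (c * (DIM('a) * \<bar>z \<bullet> b\<bar>))"
    by simp
  also have "\<dots> \<le> exp ((c * DIM('a)) *\<^sub>R b \<bullet> z) + exp ((- c * DIM('a)) *\<^sub>R b \<bullet> z)"
    by (cases "z \<bullet> b \<ge> 0") (simp_all add: inner_commute[of b z] mult.assoc)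
  also have "\<dots> \<le> (\<Sum>b\<in>Basis. exp ((c * DIM('a)) *\<^sub>R b \<bullet> z) + exp ((- c * DIM('a)) *\<^sub>R b \<bullet> z))"
    by (rule member_le_sum[OF b]) (simp_all add: add_nonneg_nonneg)
  finally show ?thesis .
qed

text \<open>One noise step in the abstract: \<open>F\<close> is the past and \<open>Z\<close> the
  next noise vector. The weights \<open>W\<close> in the lemmas below stand for the exponentiated
  potential of the past.\<close>

locale cond_subgaussian = sigma_finite_subalgebra M F for M F :: "'b measure" +
  fixes Z :: "'b \<Rightarrow> 'a::euclidean_space" and s :: real
  assumes Z_measurable [measurable]: "Z \<in> borel_measurable M"
    and cond_mgf_le: "\<And>a. AE x in M. nn_cond_exp M F (\<lambda>x. ennreal (exp (a \<bullet> Z x))) x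
      \<le> ennreal (exp (s\<^sup>2 * (norm a)\<^sup>2 / 2))"
begin

lemma F_measurable_imp_M: "f \<in> measurable F N \<Longrightarrow> f \<in> measurable M N"
  using measurable_from_subalg[OF subalg] .

text \<open>An \<open>F\<close>-measurable weight passes through the conditional expectation, so the
  pointwise conditional bound integrates against it.\<close>

lemma weighted_mgf_const:
  assumes W: "W \<in> borel_measurable F"
  shows "(\<integral>\<^sup>+x. W x * ennreal (exp (a \<bullet> Z x)) \<partial>M)
    \<le> ennreal (exp (s\<^sup>2 * (norm a)\<^sup>2 / 2)) * (\<integral>\<^sup>+x. W x \<partial>M)"
proof -
  have [measurable]: "W \<in> borel_measurable M"
    using W by (rule F_measurable_imp_M)
  have "(\<integral>\<^sup>+x. W x * ennreal (exp (a \<bullet> Z x)) \<partial>M)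
      = (\<integral>\<^sup>+x. W x * nn_cond_exp M F (\<lambda>x. ennreal (exp (a \<bullet> Z x))) x \<partial>M)"
    by (rule nn_cond_exp_intg[symmetric]) (use W in measurable)
  also have "\<dots> \<le> (\<integral>\<^sup>+x. W x * ennreal (exp (s\<^sup>2 * (norm a)\<^sup>2 / 2)) \<partial>M)"
    by (rule nn_integral_mono_AE, rule AE_mp[OF cond_mgf_le[of a]]) (auto intro!: mult_left_mono)
  also have "\<dots> = ennreal (exp (s\<^sup>2 * (norm a)\<^sup>2 / 2)) * (\<integral>\<^sup>+x. W x \<partial>M)"
    by (simp add: nn_integral_multc mult.commute)
  finally show ?thesis .
qed

text \<open>
  The exceptional null set of the conditional bound depends on \<open>a\<close>, so an \<open>F\<close>-measurable random
  direction is reached through simple functions and Fatou's lemma.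
\<close>

lemma weighted_mgf_simple:
  assumes W: "W \<in> borel_measurable F" and A: "simple_function F A"
    and bound: "\<And>x. x \<in> space M \<Longrightarrow> norm (A x) \<le> \<theta>"
  shows "(\<integral>\<^sup>+x. W x * ennreal (exp (A x \<bullet> Z x)) \<partial>M)
    \<le> ennreal (exp (s\<^sup>2 * \<theta>\<^sup>2 / 2)) * (\<integral>\<^sup>+x. W x \<partial>M)"
proof -
  have sp: "space F = space M"
    using subalg by (simp add: subalgebra_def)
  \<comment> \<open>On a level set of \<open>A\<close> the direction is constant. Absorbing the
    indicator of the level set into the weight leads back to
    \<open>weighted_mgf_const\<close>.\<close>
  define V where "V a x = W x * indicator (A -` {a} \<inter> space F) x" for a x
  have fin: "finite (A ` space F)"
    using A by (rule simple_functionD(1))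
  have AF: "A -` {a} \<inter> space F \<in> sets F" for a
    using A by (rule simple_functionD(2))
  have V: "V a \<in> borel_measurable F" for a
    unfolding V_def using W AF by measurable
  note VM [measurable] = F_measurable_imp_M[OF V]
  have split: "c x = (\<Sum>a\<in>A ` space F. indicator (A -` {a} \<inter> space F) x * c x)"
    if "x \<in> space M" for x and c :: "'b \<Rightarrow> ennreal"
  proof -
    have "(\<Sum>a\<in>A ` space F. indicator (A -` {a} \<inter> space F) x * c x)
        = (\<Sum>a\<in>A ` space F. if a = A x then c x else 0)"
      using that by (intro sum.cong) (auto simp: indicator_def sp)
    also have "\<dots> = c x"
      using fin that by (simp add: sp)
    finally show ?thesis ..
  qed
  have "(\<integral>\<^sup>+x. W x * ennreal (exp (A x \<bullet> Z x)) \<partial>M)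
      = (\<integral>\<^sup>+x. (\<Sum>a\<in>A ` space F. V a x * ennreal (exp (a \<bullet> Z x))) \<partial>M)"
    by (rule nn_integral_cong, subst split) (auto intro!: sum.cong simp: V_def indicator_def)
  also have "\<dots> = (\<Sum>a\<in>A ` space F. \<integral>\<^sup>+x. V a x * ennreal (exp (a \<bullet> Z x)) \<partial>M)"
    by (rule nn_integral_sum) measurable
  also have "\<dots> \<le> (\<Sum>a\<in>A ` space F. ennreal (exp (s\<^sup>2 * \<theta>\<^sup>2 / 2)) * (\<integral>\<^sup>+x. V a x \<partial>M))"
  proof (rule sum_mono)
    fix a assume "a \<in> A ` space F"
    then have "norm a \<le> \<theta>"
      using bound by (auto simp: sp)
    then have "s\<^sup>2 * (norm a)\<^sup>2 / 2 \<le> s\<^sup>2 * \<theta>\<^sup>2 / 2"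
      by (intro divide_right_mono mult_left_mono power_mono) auto
    then show "(\<integral>\<^sup>+x. V a x * ennreal (exp (a \<bullet> Z x)) \<partial>M)
        \<le> ennreal (exp (s\<^sup>2 * \<theta>\<^sup>2 / 2)) * (\<integral>\<^sup>+x. V a x \<partial>M)"
      by (intro order_trans[OF weighted_mgf_const[OF V]] mult_right_mono ennreal_leI) auto
  qed
  also have "\<dots> = ennreal (exp (s\<^sup>2 * \<theta>\<^sup>2 / 2)) * (\<integral>\<^sup>+x. (\<Sum>a\<in>A ` space F. V a x) \<partial>M)"
    by (simp add: nn_integral_sum sum_distrib_left)
  also have "(\<integral>\<^sup>+x. (\<Sum>a\<in>A ` space F. V a x) \<partial>M) = (\<integral>\<^sup>+x. W x \<partial>M)"
    by (rule nn_integral_cong, subst (2) split) (auto intro!: sum.cong simp: V_def mult.commute)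
  finally show ?thesis .
qed

lemma weighted_mgf:
  assumes W: "W \<in> borel_measurable F" and A: "A \<in> borel_measurable F"
    and bound: "\<And>x. x \<in> space M \<Longrightarrow> norm (A x) \<le> \<theta>" and "\<theta> > 0"
  shows "(\<integral>\<^sup>+x. W x * ennreal (exp (A x \<bullet> Z x)) \<partial>M)
    \<le> ennreal (exp (s\<^sup>2 * \<theta>\<^sup>2 / 2)) * (\<integral>\<^sup>+x. W x \<partial>M)"
proof -
  have sp: "space F = space M"
    using subalg by (simp add: subalgebra_def)
  obtain G where G: "\<And>i. simple_function F (G i)"
    and lim: "\<And>x. x \<in> space F \<Longrightarrow> (\<lambda>i. G i x) \<longlonglongrightarrow> A x"
    using borel_measurable_implies_sequence_metric[OF A] by metis
  \<comment> \<open>The approximants may leave the ball of radius \<open>\<theta>\<close>, so they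
    are rescaled into it. In the limit the rescaling disappears, because \<open>A\<close> stays in
    the ball.\<close>
  define B where "B i x = (\<theta> / max \<theta> (norm (G i x))) *\<^sub>R G i x" for i x
  have B: "simple_function F (B i)" for i
    unfolding B_def by (rule simple_function_compose1[OF G])
  have normB: "norm (B i x) \<le> \<theta>" for i x
    using \<open>\<theta> > 0\<close> by (auto simp: B_def max_def field_simps)
  have limB: "(\<lambda>i. B i x) \<longlonglongrightarrow> A x" if "x \<in> space M" for x
  proof -
    have "(\<lambda>i. B i x) \<longlonglongrightarrow> (\<theta> / max \<theta> (norm (A x))) *\<^sub>R A x"
      unfolding B_def using lim that \<open>\<theta> > 0\<close> by (intro tendsto_intros) (auto simp: sp max_def)
    then show ?thesis
      using bound[OF that] \<open>\<theta> > 0\<close> by (simp add: max_absorb1)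
  qed
  have [measurable]: "W \<in> borel_measurable M" "\<And>i. B i \<in> borel_measurable M"
    using W borel_measurable_simple_function[OF B] by (auto intro: F_measurable_imp_M)
  have "(\<integral>\<^sup>+x. W x * ennreal (exp (A x \<bullet> Z x)) \<partial>M)
      = (\<integral>\<^sup>+x. liminf (\<lambda>i. W x * ennreal (exp (B i x \<bullet> Z x))) \<partial>M)"
  proof (rule nn_integral_cong)
    fix x assume x: "x \<in> space M"
    have "(\<lambda>i. W x * ennreal (exp (B i x \<bullet> Z x))) \<longlonglongrightarrow> W x * ennreal (exp (A x \<bullet> Z x))"
    \<comment> \<open>Multiplication by an infinite constant is not continuous on the extended
      reals; there both sides equal \<open>\<top>\<close>, as the exponentials are positive.\<close>
    proof (cases "W x = \<top>")
      case True
      then show ?thesis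
        by (simp add: ennreal_top_mult)
    next
      case False
      then show ?thesis
        by (intro ennreal_tendsto_cmult tendsto_ennrealI tendsto_intros limB[OF x])
          (simp add: less_top)
    qed
    then show "W x * ennreal (exp (A x \<bullet> Z x)) = liminf (\<lambda>i. W x * ennreal (exp (B i x \<bullet> Z x)))"
      by (simp add: lim_imp_Liminf)
  qed
  also have "\<dots> \<le> liminf (\<lambda>i. \<integral>\<^sup>+x. W x * ennreal (exp (B i x \<bullet> Z x)) \<partial>M)"
    by (rule nn_integral_liminf) measurable
  also have "\<dots> \<le> liminf (\<lambda>i::nat. ennreal (exp (s\<^sup>2 * \<theta>\<^sup>2 / 2)) * (\<integral>\<^sup>+x. W x \<partial>M))"
    by (intro Liminf_mono always_eventually allI weighted_mgf_simple[OF W B] normB)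
  also have "\<dots> = ennreal (exp (s\<^sup>2 * \<theta>\<^sup>2 / 2)) * (\<integral>\<^sup>+x. W x \<partial>M)"
    by (simp add: Liminf_const)
  finally show ?thesis .
qed

text \<open>Only the second-order error of a step is estimated this way. It carries the small factor
  \<open>\<eta> / \<kappa>\<close>, so a crude constant depending on the dimension does no
  harm.\<close>

lemma weighted_exp_norm:
  fixes c :: real
  assumes W: "W \<in> borel_measurable F" and "c \<ge> 0"
  shows "(\<integral>\<^sup>+x. W x * ennreal (exp (c * norm (Z x))) \<partial>M)
    \<le> ennreal (2 * DIM('a) * exp (s\<^sup>2 * (c * DIM('a))\<^sup>2 / 2)) * (\<integral>\<^sup>+x. W x \<partial>M)"
proof -
  have [measurable]: "W \<in> borel_measurable M"
    using W by (rule F_measurable_imp_M)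
  define E where "E a = (\<integral>\<^sup>+x. W x * ennreal (exp (a \<bullet> Z x)) \<partial>M)" for a
  let ?r = "c * DIM('a)"
  have E: "E (t *\<^sub>R b) \<le> ennreal (exp (s\<^sup>2 * ?r\<^sup>2 / 2)) * (\<integral>\<^sup>+x. W x \<partial>M)"
    if "b \<in> Basis" "\<bar>t\<bar> = ?r" for t b
    using weighted_mgf_const[OF W, of "t *\<^sub>R b"] that by (simp add: E_def)
  have "(\<integral>\<^sup>+x. W x * ennreal (exp (c * norm (Z x))) \<partial>M)
      \<le> (\<integral>\<^sup>+x. (\<Sum>b\<in>Basis. W x * ennreal (exp (?r *\<^sub>R b \<bullet> Z x)) + W x * ennreal (exp ((- ?r) *\<^sub>R b \<bullet> Z x))) \<partial>M)"
  proof (rule nn_integral_mono)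
    fix x
    have "W x * ennreal (exp (c * norm (Z x)))
        \<le> W x * ennreal (\<Sum>b\<in>Basis. exp (?r *\<^sub>R b \<bullet> Z x) + exp ((- ?r) *\<^sub>R b \<bullet> Z x))"
      using exp_norm_le[OF \<open>c \<ge> 0\<close>, of "Z x"] by (intro mult_left_mono ennreal_leI) auto
    also have "\<dots> = (\<Sum>b\<in>Basis. W x * ennreal (exp (?r *\<^sub>R b \<bullet> Z x)) + W x * ennreal (exp ((- ?r) *\<^sub>R b \<bullet> Z x)))"
      by (subst sum_ennreal[symmetric]) (auto simp: sum_distrib_left distrib_left intro: add_nonneg_nonneg)
    finally show "W x * ennreal (exp (c * norm (Z x)))
        \<le> (\<Sum>b\<in>Basis. W x * ennreal (exp (?r *\<^sub>R b \<bullet> Z x)) + W x * ennreal (exp ((- ?r) *\<^sub>R b \<bullet> Z x)))" .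
  qed
  also have "\<dots> = (\<Sum>b\<in>Basis. E (?r *\<^sub>R b) + E ((- ?r) *\<^sub>R b))"
    unfolding E_def by (subst nn_integral_sum) (auto simp: nn_integral_add)
  also have "\<dots> \<le> (\<Sum>b\<in>(Basis :: 'a set). 2 * (ennreal (exp (s\<^sup>2 * ?r\<^sup>2 / 2)) * (\<integral>\<^sup>+x. W x \<partial>M)))"
    unfolding mult_2 using \<open>c \<ge> 0\<close> by (intro sum_mono add_mono E) auto
  also have "\<dots> = ennreal (2 * DIM('a) * exp (s\<^sup>2 * ?r\<^sup>2 / 2)) * (\<integral>\<^sup>+x. W x \<partial>M)"
    by (simp add: ennreal_mult ennreal_of_nat_eq_real_of_nat mult_ac)
  finally show ?thesis .
qed

end

section \<open>Deterministic one-step estimates for the square root\<close>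

text \<open>The first bound is the tangent of the concave square root at \<open>Y\<^sup>2\<close>:
  accurate, but quadratic in the noise. The second comes from Cauchy-Schwarz and is coarser, but
  linear in the noise. Both are needed in \<open>exp_sqrt_increment_le\<close>.\<close>

lemma sqrt_increment_le:
  fixes u e g :: "'a::real_inner"
  assumes "Y > 0" "\<eta> \<ge> 0" "norm u \<le> Y" "norm g \<le> L"
  defines "Y' \<equiv> sqrt (Y\<^sup>2 - 2 * \<eta> * (e \<bullet> u) + \<eta>\<^sup>2 * (norm (g + e))\<^sup>2)"
  shows "Y' \<le> Y - \<eta> * (e \<bullet> u) / Y + \<eta>\<^sup>2 * (L + norm e)\<^sup>2 / (2 * Y)"
    and "Y' \<le> Y + \<eta> * (L + norm e)"
proof -
  define q where "q = L + norm e"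
  have "norm (g + e) \<le> q"
    using norm_triangle_ineq[of g e] assms by (simp add: q_def)
  then have "(norm (g + e))\<^sup>2 \<le> q\<^sup>2"
    by (intro power_mono) auto
  then have ge: "\<eta>\<^sup>2 * (norm (g + e))\<^sup>2 \<le> \<eta>\<^sup>2 * q\<^sup>2"
    by (intro mult_left_mono) auto
  have "0 \<le> L"
    using assms(4) norm_ge_zero[of g] by linarith
  then have q: "norm e \<le> q" "0 \<le> q"
    by (auto simp: q_def)
  have "\<bar>e \<bullet> u\<bar> \<le> norm e * norm u"
    by (rule Cauchy_Schwarz_ineq2)
  also have "\<dots> \<le> q * Y"
    using q assms by (intro mult_mono) auto
  finally have eu: "\<bar>e \<bullet> u\<bar> \<le> q * Y" .
  then have eu': "\<bar>\<eta> * (e \<bullet> u)\<bar> \<le> \<eta> * q * Y"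
    using mult_left_mono[OF eu \<open>\<eta> \<ge> 0\<close>] \<open>\<eta> \<ge> 0\<close> by (simp add: abs_mult)
  define t where "t = - \<eta> * (e \<bullet> u) / Y + \<eta>\<^sup>2 * q\<^sup>2 / (2 * Y)"
  have t: "2 * Y * t = - 2 * \<eta> * (e \<bullet> u) + \<eta>\<^sup>2 * q\<^sup>2"
    using \<open>Y > 0\<close> by (simp add: t_def field_simps)
  \<comment> \<open>Squaring the tangent bound requires \<open>Y + t\<close> to be nonnegative, and
    this sum of squares certifies it.\<close>
  have "0 \<le> Y\<^sup>2 + (Y - \<eta> * q)\<^sup>2"
    by simp
  also have "\<dots> \<le> 2 * Y * (Y + t)"
    using eu' t by (simp add: power2_eq_square algebra_simps)
  finally have "0 \<le> Y + t"
    using \<open>Y > 0\<close> by (simp add: zero_le_mult_iff)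
  moreover have "Y\<^sup>2 - 2 * \<eta> * (e \<bullet> u) + \<eta>\<^sup>2 * (norm (g + e))\<^sup>2 \<le> (Y + t)\<^sup>2"
    using ge t zero_le_power2[of t] unfolding power2_sum by linarith
  ultimately have "Y' \<le> Y + t"
    unfolding Y'_def by (intro real_le_lsqrt)
  then show "Y' \<le> Y - \<eta> * (e \<bullet> u) / Y + \<eta>\<^sup>2 * (L + norm e)\<^sup>2 / (2 * Y)"
    by (simp add: t_def q_def)
  have "Y\<^sup>2 - 2 * \<eta> * (e \<bullet> u) + \<eta>\<^sup>2 * (norm (g + e))\<^sup>2 \<le> (Y + \<eta> * q)\<^sup>2"
    using ge eu' by (simp add: power2_sum power_mult_distrib abs_le_iff mult_ac)
  then show "Y' \<le> Y + \<eta> * (L + norm e)"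
    unfolding Y'_def q_def[symmetric] using assms q by (intro real_le_lsqrt) auto
qed

text \<open>From \<open>exp Q \<le> 1 + Q * exp Q\<close>, with separate bounds for the two
  occurrences of \<open>Q\<close>: the small \<open>b\<close> for the factor and \<open>B\<close>
  for the exponent. In the application \<open>b\<close> is quadratic in the noise and must stay out
  of the exponent, where only linear growth is controlled.\<close>

lemma exp_add_le:
  fixes T Q :: real
  assumes "Q \<le> b" "Q \<le> B" "0 \<le> b"
  shows "exp (T + Q) \<le> exp T + exp T * b * exp B"
proof (cases "Q \<le> 0")
  case True
  then have "exp (T + Q) \<le> exp T"
    by simp
  also have "\<dots> \<le> exp T + exp T * b * exp B"
    using assms by simp
  finally show ?thesis .
next
  case False
  have "exp Q * (1 - Q) \<le> exp Q * exp (- Q)"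
    using exp_ge_add_one_self[of "- Q"] by (intro mult_left_mono) auto
  then have "exp Q \<le> 1 + Q * exp Q"
    by (simp add: exp_minus algebra_simps)
  also have "\<dots> \<le> 1 + b * exp B"
    using assms False by (intro add_left_mono mult_mono) auto
  finally have "exp T * exp Q \<le> exp T * (1 + b * exp B)"
    by (intro mult_left_mono) auto
  then show ?thesis
    by (simp add: exp_add algebra_simps)
qed

text \<open>The increment of the exponent is split into the linear noise term \<open>T\<close>,
  whose direction has norm at most \<open>\<theta>\<close>, and a remainder \<open>Q\<close>. The
  former keeps the sharp sub-Gaussian constant; the latter costs only a term of order
  \<open>\<eta> / \<kappa>\<close>.\<close>

lemma exp_sqrt_increment_le:
  fixes u e g :: "'a::real_inner"
  assumes "0 < \<kappa>" "\<kappa> \<le> Y" "\<eta> > 0" "\<theta> > 0" "norm u \<le> Y" "norm g \<le> L"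
  defines "Y' \<equiv> sqrt (Y\<^sup>2 - 2 * \<eta> * (e \<bullet> u) + \<eta>\<^sup>2 * (norm (g + e))\<^sup>2)"
  defines "c \<equiv> 3 * \<theta> + 1"
  shows "exp (\<theta> / \<eta> * Y') \<le> exp (\<theta> / \<eta> * Y) *
    (exp ((- (\<theta> / Y) *\<^sub>R u) \<bullet> e) + \<eta> / \<kappa> * \<theta> * exp (c * L) * exp (c * norm e))"
proof -
  define q where "q = L + norm e"
  define T where "T = (- (\<theta> / Y) *\<^sub>R u) \<bullet> e"
  define Q where "Q = \<theta> / \<eta> * (Y' - Y) - T"
  define b where "b = \<theta> * \<eta> * q\<^sup>2 / (2 * \<kappa>)"
  have "Y > 0"
    using assms by linarith
  have "0 \<le> L"
    using \<open>norm g \<le> L\<close> norm_ge_zero[of g] by linarith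
  then have q: "0 \<le> q" "norm e \<le> q"
    by (auto simp: q_def)
  note inc = sqrt_increment_le[OF \<open>Y > 0\<close> less_imp_le[OF \<open>\<eta> > 0\<close>] \<open>norm u \<le> Y\<close> \<open>norm g \<le> L\<close>,
      of e, folded Y'_def q_def]
  have T: "\<bar>T\<bar> \<le> \<theta> * q"
  proof -
    have "\<bar>T\<bar> \<le> norm (- (\<theta> / Y) *\<^sub>R u) * norm e"
      unfolding T_def by (rule Cauchy_Schwarz_ineq2)
    also have "\<dots> \<le> \<theta> * q"
    proof (rule mult_mono)
      show "norm (- (\<theta> / Y) *\<^sub>R u) \<le> \<theta>"
        using assms \<open>Y > 0\<close> by (simp add: pos_divide_le_eq)
    qed (use q assms in auto)
    finally show ?thesis .
  qed
  \<comment> \<open>The linear term of the tangent bound is exactly \<open>T\<close>, so only the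
    quadratic part survives.\<close>
  have "Q \<le> \<theta> / \<eta> * (- \<eta> * (e \<bullet> u) / Y + \<eta>\<^sup>2 * q\<^sup>2 / (2 * Y)) - T"
    unfolding Q_def using inc(1) assms by (intro diff_right_mono mult_left_mono) auto
  also have "\<dots> = \<theta> * \<eta> * q\<^sup>2 / (2 * Y)"
    using \<open>Y > 0\<close> \<open>\<eta> > 0\<close> by (simp add: T_def inner_commute field_simps power2_eq_square)
  also have "\<dots> \<le> b"
    unfolding b_def using assms \<open>Y > 0\<close> by (intro divide_left_mono) auto
  finally have Qb: "Q \<le> b" .
  have "Q \<le> \<theta> / \<eta> * (\<eta> * q) + \<theta> * q"
    unfolding Q_def using inc(2) assms T mult_left_mono[of "Y' - Y" "\<eta> * q" "\<theta> / \<eta>"]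
    by (simp add: abs_le_iff)
  then have QB: "Q \<le> 2 * \<theta> * q"
    using \<open>\<eta> > 0\<close> by simp
  have "0 \<le> b"
    using assms by (simp add: b_def)
  \<comment> \<open>The quadratic noise factor is traded for an exponential that is linear in the
    noise norm.\<close>
  have "q\<^sup>2 \<le> 2 * exp q"
    using exp_lower_Taylor_quadratic[OF \<open>0 \<le> q\<close>] \<open>0 \<le> q\<close> by simp
  then have b: "b \<le> \<eta> / \<kappa> * \<theta> * exp q"
    unfolding b_def using assms mult_left_mono[of "q\<^sup>2" "2 * exp q" "\<theta> * \<eta>"] by (simp add: field_simps)
  have "exp (\<theta> / \<eta> * Y') = exp (\<theta> / \<eta> * Y) * exp (T + Q)"
    by (simp add: Q_def exp_add[symmetric] right_diff_distrib)
  also have "exp (T + Q) \<le> exp T + exp T * b * exp (2 * \<theta> * q)"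
    by (rule exp_add_le[OF Qb QB \<open>0 \<le> b\<close>])
  also have "exp T * b * exp (2 * \<theta> * q) \<le> exp (\<theta> * q) * (\<eta> / \<kappa> * \<theta> * exp q) * exp (2 * \<theta> * q)"
    using T b \<open>0 \<le> b\<close> assms by (intro mult_mono mult_right_mono) (auto simp: abs_le_iff)
  also have "\<dots> = \<eta> / \<kappa> * \<theta> * (exp (\<theta> * q) * exp q * exp (2 * \<theta> * q))"
    by simp
  \<comment> \<open>The constant \<open>c = 3 * \<theta> + 1\<close> collects
    \<open>\<theta>\<close> from \<open>exp T\<close>, \<open>2 * \<theta>\<close> from the coarse
    bound on \<open>Q\<close>, and 1 from the estimate of \<open>q\<^sup>2\<close>.\<close>
  also have "exp (\<theta> * q) * exp q * exp (2 * \<theta> * q) = exp (c * L) * exp (c * norm e)"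
    by (simp add: q_def c_def exp_add[symmetric] algebra_simps)
  finally show ?thesis
    by (simp add: T_def mult.assoc)
qed

section \<open>Noise history and adaptedness of the iterates\<close>

lemma measurable_noise_coordinate:
  assumes "j < k"
  shows "(\<lambda>e. e j) \<in> borel_measurable (noise_history k :: (nat \<Rightarrow> 'a::euclidean_space) measure)"
proof (rule measurableI)
  fix B :: "'a set" assume "B \<in> sets borel"
  then show "(\<lambda>e. e j) -` B \<inter> space (noise_history k) \<in> sets (noise_history k)"
    using assms by (auto simp: noise_history_def)
qed simp

lemma measurable_sgd_iterate:
  assumes "g \<in> borel_measurable borel" and "j \<le> k"
  shows "(\<lambda>e. sgd_iterate x0 \<eta> g e j) \<in> borel_measurable (noise_history k)"
  using \<open>j \<le> k\<close>
proof (induction j)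
  case (Suc j)
  note [measurable] = assms(1)
  have [measurable]: "(\<lambda>e. sgd_iterate x0 \<eta> g e j) \<in> borel_measurable (noise_history k)"
    using Suc by simp
  have [measurable]: "(\<lambda>e. e j) \<in> borel_measurable (noise_history k :: (nat \<Rightarrow> 'a) measure)"
    using Suc by (intro measurable_noise_coordinate) simp
  show ?case
    unfolding sgd_iterate.simps by measurable
qed simp

lemma cond_subgaussian_noise:
  assumes "P \<in> admissible_laws s"
  shows "cond_subgaussian P (noise_history k) (\<lambda>e. e k) s"
proof -
  have P: "prob_space P" and sets: "sets P = sets (\<Pi>\<^sub>M k\<in>UNIV. borel)"
    and mgf: "\<And>a. AE e in P. nn_cond_exp P (noise_history k) (\<lambda>e. ennreal (exp (a \<bullet> e k))) e
          \<le> ennreal (exp (s\<^sup>2 * (norm a)\<^sup>2 / 2))"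
    using assms by (auto simp: admissible_laws_def)
  interpret prob_space P by fact
  interpret finite_measure_subalgebra P "noise_history k"
    by unfold_locales (rule subalgebra_noise_history[OF sets])
  show ?thesis
  proof
    show "(\<lambda>e. e k) \<in> borel_measurable P"
      unfolding measurable_cong_sets[OF sets refl] by (rule measurable_component_singleton) simp
  qed (rule mgf)
qed

section \<open>The potential of the method and its exponential moments\<close>

text \<open>
  Keeping the regret inside the square makes the inner products with the subgradients cancel in one
  step (\<open>sgd_potential_Suc\<close> below), and the offset \<open>\<kappa>\<close> keeps the square root away from its
  singularity at 0.
\<close>

definition sgd_potential ::
    "'a::euclidean_space \<Rightarrow> 'a \<Rightarrow> real \<Rightarrow> real \<Rightarrow> ('a \<Rightarrow> 'a) \<Rightarrow> nat \<Rightarrow> (nat \<Rightarrow> 'a) \<Rightarrow> real" where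
  "sgd_potential x0 xs \<kappa> \<eta> g k e = sqrt (\<kappa>\<^sup>2 + (norm (sgd_iterate x0 (\<lambda>_. \<eta>) g e k - xs))\<^sup>2 +
     2 * \<eta> * (\<Sum>j<k. g (sgd_iterate x0 (\<lambda>_. \<eta>) g e j) \<bullet> (sgd_iterate x0 (\<lambda>_. \<eta>) g e j - xs)))"

lemma measurable_sgd_potential:
  assumes "g \<in> borel_measurable borel"
  shows "sgd_potential x0 xs \<kappa> \<eta> g k \<in> borel_measurable (noise_history k)"
proof -
  note [measurable] = assms measurable_sgd_iterate[OF assms]
  show ?thesis
    unfolding sgd_potential_def by measurable
qed

text \<open>The coefficient of \<open>\<eta> / \<kappa>\<close> in the one-step moment bound: the
  prefactor from \<open>exp_sqrt_increment_le\<close> times the constant of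
  \<open>weighted_exp_norm\<close> at \<open>c = 3 * \<theta> + 1\<close>. It is free of the step
  size and the horizon; the type argument supplies the dimension.\<close>

definition excess_const :: "'a::euclidean_space itself \<Rightarrow> real \<Rightarrow> real \<Rightarrow> real \<Rightarrow> real" where
  "excess_const _ s L \<theta> = \<theta> * exp ((3 * \<theta> + 1) * L) *
     (2 * real DIM('a) * exp (s\<^sup>2 * ((3 * \<theta> + 1) * real DIM('a))\<^sup>2 / 2))"

context
  fixes x0 xs :: "'a::euclidean_space" and g :: "'a \<Rightarrow> 'a" and \<kappa> \<eta> L :: real
  assumes \<kappa>: "\<kappa> > 0" and \<eta>: "\<eta> > 0"
    and g_measurable: "g \<in> borel_measurable borel"
    and g_norm: "\<And>x. norm (g x) \<le> L"
    and g_monotone: "\<And>x. 0 \<le> g x \<bullet> (x - xs)"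
begin

private abbreviation "X e k \<equiv> sgd_iterate x0 (\<lambda>_. \<eta>) g e k"
private abbreviation "Y \<equiv> sgd_potential x0 xs \<kappa> \<eta> g"

lemma sgd_potential_power2:
  "(Y k e)\<^sup>2 = \<kappa>\<^sup>2 + (norm (X e k - xs))\<^sup>2 + 2 * \<eta> * (\<Sum>j<k. g (X e j) \<bullet> (X e j - xs))"
  unfolding sgd_potential_def using \<eta> g_monotone
  by (intro real_sqrt_pow2 add_nonneg_nonneg mult_nonneg_nonneg sum_nonneg) auto

lemma sgd_potential_ge:
  "\<kappa> \<le> Y k e" "norm (X e k - xs) \<le> Y k e"
proof -
  have "0 \<le> 2 * \<eta> * (\<Sum>j<k. g (X e j) \<bullet> (X e j - xs))"
    using \<eta> g_monotone by (intro mult_nonneg_nonneg sum_nonneg) auto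
  then show "\<kappa> \<le> Y k e" "norm (X e k - xs) \<le> Y k e"
    unfolding sgd_potential_def by (auto intro!: real_le_rsqrt simp: add_increasing)
qed

lemma sgd_potential_Suc:
  "Y (Suc k) e = sqrt ((Y k e)\<^sup>2 - 2 * \<eta> * (e k \<bullet> (X e k - xs)) + \<eta>\<^sup>2 * (norm (g (X e k) + e k))\<^sup>2)"
proof -
  have expand: "(norm (v - \<eta> *\<^sub>R w))\<^sup>2 = (norm v)\<^sup>2 - 2 * \<eta> * (w \<bullet> v) + \<eta>\<^sup>2 * (norm w)\<^sup>2" for v w :: 'a
    unfolding power2_norm_eq_inner
    by (simp add: inner_diff_left inner_diff_right inner_commute[of v w] power2_eq_square algebra_simps)
  have "X e (Suc k) - xs = (X e k - xs) - \<eta> *\<^sub>R (g (X e k) + e k)"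
    by simp
  then have "(norm (X e (Suc k) - xs))\<^sup>2 = (norm (X e k - xs))\<^sup>2
      - 2 * \<eta> * ((g (X e k) + e k) \<bullet> (X e k - xs)) + \<eta>\<^sup>2 * (norm (g (X e k) + e k))\<^sup>2"
    by (simp only: expand)
  then show ?thesis
    unfolding sgd_potential_power2 sgd_potential_def[of _ _ _ _ _ "Suc k"]
    by (simp add: inner_add_left algebra_simps del: sgd_iterate.simps)
qed

text \<open>The weight \<open>W\<close> and the direction \<open>A\<close> depend only on the first
  \<open>k\<close> noise vectors. After the pointwise splitting, the main term falls to
  \<open>weighted_mgf\<close> and the remainder to \<open>weighted_exp_norm\<close>.\<close>

lemma exp_moment_Suc:
  assumes P: "P \<in> admissible_laws s" and "\<theta> > 0"
  shows "(\<integral>\<^sup>+e. ennreal (exp (\<theta> / \<eta> * Y (Suc k) e)) \<partial>P) \<le>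
    ennreal (exp (s\<^sup>2 * \<theta>\<^sup>2 / 2 + \<eta> / \<kappa> * excess_const TYPE('a) s L \<theta>)) *
    (\<integral>\<^sup>+e. ennreal (exp (\<theta> / \<eta> * Y k e)) \<partial>P)"
proof -
  interpret cond_subgaussian P "noise_history k" "\<lambda>e. e k" s
    by (rule cond_subgaussian_noise[OF P])
  define c where "c = 3 * \<theta> + 1"
  define b where "b = \<eta> / \<kappa> * \<theta> * exp (c * L)"
  define W where "W e = ennreal (exp (\<theta> / \<eta> * Y k e))" for e
  define A where "A e = - (\<theta> / Y k e) *\<^sub>R (X e k - xs)" for e
  have "b \<ge> 0" "c \<ge> 0"
    using \<kappa> \<eta> \<open>\<theta> > 0\<close> by (auto simp: b_def c_def)
  note [measurable] = measurable_sgd_potential[OF g_measurable] measurable_sgd_iterate[OF g_measurable]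
  have W: "W \<in> borel_measurable (noise_history k)" and A: "A \<in> borel_measurable (noise_history k)"
    unfolding W_def A_def by measurable
  note [measurable] = F_measurable_imp_M[OF W] F_measurable_imp_M[OF A]
  have A_le: "norm (A e) \<le> \<theta>" for e
    using sgd_potential_ge[where k = k and e = e] \<kappa> \<open>\<theta> > 0\<close>
    by (simp add: A_def pos_divide_le_eq)
  have "(\<integral>\<^sup>+e. ennreal (exp (\<theta> / \<eta> * Y (Suc k) e)) \<partial>P)
      \<le> (\<integral>\<^sup>+e. W e * ennreal (exp (A e \<bullet> e k)) + ennreal b * (W e * ennreal (exp (c * norm (e k)))) \<partial>P)"
  proof (rule nn_integral_mono)
    fix e
    have "exp (\<theta> / \<eta> * Y (Suc k) e) \<le> exp (\<theta> / \<eta> * Y k e) *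
        (exp (A e \<bullet> e k) + b * exp (c * norm (e k)))"
      unfolding sgd_potential_Suc A_def b_def c_def
      by (rule exp_sqrt_increment_le) (use \<kappa> \<eta> \<open>\<theta> > 0\<close> g_norm sgd_potential_ge in auto)
    then have "ennreal (exp (\<theta> / \<eta> * Y (Suc k) e)) \<le> ennreal (exp (\<theta> / \<eta> * Y k e) *
        (exp (A e \<bullet> e k) + b * exp (c * norm (e k))))"
      by (rule ennreal_leI)
    also have "\<dots> = W e * ennreal (exp (A e \<bullet> e k)) + ennreal b * (W e * ennreal (exp (c * norm (e k))))"
      using \<open>b \<ge> 0\<close> by (simp add: W_def ennreal_mult distrib_left mult_ac)
    finally show "ennreal (exp (\<theta> / \<eta> * Y (Suc k) e))
      \<le> W e * ennreal (exp (A e \<bullet> e k)) + ennreal b * (W e * ennreal (exp (c * norm (e k))))" .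
  qed
  also have "\<dots> = (\<integral>\<^sup>+e. W e * ennreal (exp (A e \<bullet> e k)) \<partial>P)
      + ennreal b * (\<integral>\<^sup>+e. W e * ennreal (exp (c * norm (e k))) \<partial>P)"
    by (subst nn_integral_add) (auto simp: nn_integral_cmult)
  also have "\<dots> \<le> ennreal (exp (s\<^sup>2 * \<theta>\<^sup>2 / 2)) * (\<integral>\<^sup>+e. W e \<partial>P) +
      ennreal b * (ennreal (2 * DIM('a) * exp (s\<^sup>2 * (c * DIM('a))\<^sup>2 / 2)) * (\<integral>\<^sup>+e. W e \<partial>P))"
    using \<open>\<theta> > 0\<close> \<open>c \<ge> 0\<close> A_le W A
    by (intro add_mono mult_left_mono weighted_mgf weighted_exp_norm) auto
  also have "\<dots> = ennreal (exp (s\<^sup>2 * \<theta>\<^sup>2 / 2) + \<eta> / \<kappa> * excess_const TYPE('a) s L \<theta>) * (\<integral>\<^sup>+e. W e \<partial>P)"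
  proof -
    define d where "d = 2 * DIM('a) * exp (s\<^sup>2 * (c * DIM('a))\<^sup>2 / 2)"
    have "d \<ge> 0"
      by (simp add: d_def)
    then have "ennreal (exp (s\<^sup>2 * \<theta>\<^sup>2 / 2)) * w + ennreal b * (ennreal d * w)
        = ennreal (exp (s\<^sup>2 * \<theta>\<^sup>2 / 2) + b * d) * w" for w
      using \<open>b \<ge> 0\<close> by (simp add: ennreal_plus ennreal_mult distrib_right mult.assoc)
    moreover have "b * d = \<eta> / \<kappa> * excess_const TYPE('a) s L \<theta>"
      by (simp add: b_def d_def excess_const_def c_def)
    ultimately show ?thesis
      unfolding d_def[symmetric] by simp
  qed
  \<comment> \<open>The additive error becomes a factor: the first exponential is at least 1, so
    \<open>p + x \<le> p * (1 + x) \<le> p * exp x\<close>. Exponents then simply add up over the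
    steps.\<close>
  also have "\<dots> \<le> ennreal (exp (s\<^sup>2 * \<theta>\<^sup>2 / 2 + \<eta> / \<kappa> * excess_const TYPE('a) s L \<theta>)) * (\<integral>\<^sup>+e. W e \<partial>P)"
  proof (intro mult_right_mono ennreal_leI)
    define x where "x = \<eta> / \<kappa> * excess_const TYPE('a) s L \<theta>"
    have "x \<ge> 0"
      using \<kappa> \<eta> \<open>\<theta> > 0\<close> by (simp add: x_def excess_const_def)
    have "1 \<le> exp (s\<^sup>2 * \<theta>\<^sup>2 / 2)"
      by simp
    then have "exp (s\<^sup>2 * \<theta>\<^sup>2 / 2) + x \<le> exp (s\<^sup>2 * \<theta>\<^sup>2 / 2) * (1 + x)"
      using mult_right_mono[OF _ \<open>x \<ge> 0\<close>, of 1 "exp (s\<^sup>2 * \<theta>\<^sup>2 / 2)"] by (simp add: distrib_left)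
    also have "\<dots> \<le> exp (s\<^sup>2 * \<theta>\<^sup>2 / 2) * exp x"
      by (intro mult_left_mono exp_ge_add_one_self) auto
    finally show "exp (s\<^sup>2 * \<theta>\<^sup>2 / 2) + \<eta> / \<kappa> * excess_const TYPE('a) s L \<theta>
        \<le> exp (s\<^sup>2 * \<theta>\<^sup>2 / 2 + \<eta> / \<kappa> * excess_const TYPE('a) s L \<theta>)"
      by (simp add: x_def exp_add)
  qed simp
  finally show ?thesis
    by (simp add: W_def)
qed

lemma exp_moment_le:
  assumes P: "P \<in> admissible_laws s" and "\<theta> > 0"
  shows "(\<integral>\<^sup>+e. ennreal (exp (\<theta> / \<eta> * Y k e)) \<partial>P) \<le>
    ennreal (exp (\<theta> / \<eta> * (\<kappa> + norm (x0 - xs)) +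
      k * (s\<^sup>2 * \<theta>\<^sup>2 / 2 + \<eta> / \<kappa> * excess_const TYPE('a) s L \<theta>)))"
proof (induction k)
  case 0
  interpret prob_space P
    using P by (simp add: admissible_laws_def)
  have "Y 0 e \<le> \<kappa> + norm (x0 - xs)" for e
    using \<kappa> by (auto simp: sgd_potential_def power2_sum intro!: real_le_lsqrt)
  then have "exp (\<theta> / \<eta> * Y 0 e) \<le> exp (\<theta> / \<eta> * (\<kappa> + norm (x0 - xs)))" for e
    using \<open>\<theta> > 0\<close> \<eta> by (simp add: mult_left_mono divide_right_mono)
  then have "(\<integral>\<^sup>+e. ennreal (exp (\<theta> / \<eta> * Y 0 e)) \<partial>P)
      \<le> (\<integral>\<^sup>+e. ennreal (exp (\<theta> / \<eta> * (\<kappa> + norm (x0 - xs)))) \<partial>P)"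
    by (intro nn_integral_mono ennreal_leI)
  then show ?case
    by (simp add: emeasure_space_1)
next
  case (Suc k)
  define q where "q = s\<^sup>2 * \<theta>\<^sup>2 / 2 + \<eta> / \<kappa> * excess_const TYPE('a) s L \<theta>"
  have "(\<integral>\<^sup>+e. ennreal (exp (\<theta> / \<eta> * Y (Suc k) e)) \<partial>P)
      \<le> ennreal (exp q) * (\<integral>\<^sup>+e. ennreal (exp (\<theta> / \<eta> * Y k e)) \<partial>P)"
    unfolding q_def by (rule exp_moment_Suc[OF assms])
  also have "ennreal (exp q) * (\<integral>\<^sup>+e. ennreal (exp (\<theta> / \<eta> * Y k e)) \<partial>P)
      \<le> ennreal (exp q) * ennreal (exp (\<theta> / \<eta> * (\<kappa> + norm (x0 - xs)) + k * q))"
    using Suc by (intro mult_left_mono) (auto simp: q_def)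
  also have "\<dots> = ennreal (exp (\<theta> / \<eta> * (\<kappa> + norm (x0 - xs)) + Suc k * q))"
    by (simp add: ennreal_mult[symmetric] exp_add[symmetric] algebra_simps)
  finally show ?case
    by (simp add: q_def)
qed

text \<open>Jensen and the subgradient inequality bound the gap of the average by the mean of the
  regret terms, and the potential contains all of these but the last.\<close>

lemma sgd_potential_ge_of_average_gap:
  assumes f: "convex_on UNIV f" "\<And>x. g x \<in> subdifferential f x"
    and gap: "\<epsilon> \<le> f (sgd_average x0 (\<lambda>_. \<eta>) N g e) - f xs" and "\<epsilon> \<ge> 0"
  shows "sqrt (2 * \<eta> * N * \<epsilon>) \<le> Y N e + \<eta> * L"
proof -
  define \<phi> where "\<phi> j = g (X e j) \<bullet> (X e j - xs)" for j
  have f_le: "f (X e j) \<le> f xs + \<phi> j" for j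
    using f(2)[of "X e j"] by (auto simp: subdifferential_def \<phi>_def inner_diff_right dest: spec[of _ xs])
  have "f (sgd_average x0 (\<lambda>_. \<eta>) N g e) = f (\<Sum>k=0..N. (1 / real (N + 1)) *\<^sub>R X e k)"
    by (simp add: sgd_average_def scaleR_sum_right)
  also have "\<dots> \<le> (\<Sum>k=0..N. (1 / real (N + 1)) * f (X e k))"
    using f(1) by (intro convex_on_sum[where C = UNIV]) auto
  also have "\<dots> \<le> (\<Sum>k=0..N. (1 / real (N + 1)) * (f xs + \<phi> k))"
    by (intro sum_mono mult_left_mono f_le) auto
  also have "\<dots> = (1 / real (N + 1)) * (real (N + 1) * f xs + (\<Sum>k=0..N. \<phi> k))"
    unfolding sum_distrib_left[symmetric] sum.distrib by simp
  also have "\<dots> = f xs + (\<Sum>k=0..N. \<phi> k) / real (N + 1)"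
    by (simp add: field_simps)
  finally have "\<epsilon> \<le> (\<Sum>k=0..N. \<phi> k) / real (N + 1)"
    using gap by linarith
  then have "real (N + 1) * \<epsilon> \<le> (\<Sum>k=0..N. \<phi> k)"
    by (simp add: field_simps)
  \<comment> \<open>The average has \<open>N + 1\<close> points but the potential only the first
    \<open>N\<close> regret terms. The last one is at most \<open>L * Y N e\<close>, and completing
    the square turns it into the shift \<open>\<eta> * L\<close>.\<close>
  also have "\<dots> = (\<Sum>k<N. \<phi> k) + \<phi> N"
    by (simp add: atLeast0AtMost lessThan_Suc_atMost[symmetric])
  also have "\<phi> N \<le> L * Y N e"
  proof -
    have "\<phi> N \<le> norm (g (X e N)) * norm (X e N - xs)"
      unfolding \<phi>_def by (rule norm_cauchy_schwarz)
    also have "\<dots> \<le> L * Y N e"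
      using g_norm[of "X e N"] sgd_potential_ge(2)[of e N] norm_ge_zero[of "g (X e N)"]
      by (intro mult_mono) (linarith | simp)+
    finally show ?thesis .
  qed
  finally have "2 * \<eta> * (real (N + 1) * \<epsilon>) \<le> 2 * \<eta> * ((\<Sum>k<N. \<phi> k) + L * Y N e)"
    using \<eta> by (intro mult_left_mono) auto
  moreover have "2 * \<eta> * (\<Sum>k<N. \<phi> k) \<le> (Y N e)\<^sup>2"
    unfolding sgd_potential_power2 \<phi>_def by simp
  moreover have "2 * \<eta> * N * \<epsilon> \<le> 2 * \<eta> * (real (N + 1) * \<epsilon>)"
    using \<eta> \<open>\<epsilon> \<ge> 0\<close> by (simp add: algebra_simps)
  moreover have "2 * \<eta> * ((\<Sum>k<N. \<phi> k) + L * Y N e) = 2 * \<eta> * (\<Sum>k<N. \<phi> k) + 2 * Y N e * (\<eta> * L)"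
    by (simp add: algebra_simps)
  moreover have "(Y N e)\<^sup>2 + 2 * Y N e * (\<eta> * L) \<le> (Y N e + \<eta> * L)\<^sup>2"
    by (simp add: power2_sum)
  ultimately have "2 * \<eta> * N * \<epsilon> \<le> (Y N e + \<eta> * L)\<^sup>2"
    by linarith
  moreover have "0 \<le> Y N e + \<eta> * L"
    using sgd_potential_ge(1)[of N e] \<kappa> \<eta> g_norm[of x0] norm_ge_zero[of "g x0"]
    by (intro add_nonneg_nonneg mult_nonneg_nonneg) linarith+
  ultimately show ?thesis
    by (intro real_le_lsqrt)
qed

text \<open>Markov's inequality for \<open>exp (l * Y N)\<close>: failure forces
  \<open>Y N \<ge> r\<close>, and \<open>exp_moment_le\<close> bounds the moment.\<close>

lemma failure_prob_le:
  assumes P: "P \<in> admissible_laws s" and "\<theta> > 0"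
    and f: "convex_on UNIV f" "\<And>x. g x \<in> subdifferential f x" "\<And>x. f xs \<le> f x"
    and "\<epsilon> \<ge> 0" and R: "norm (x0 - xs) \<le> R"
  shows "emeasure P {e \<in> space P. f (sgd_average x0 (\<lambda>_. \<eta>) N g e) - f (ARG_MIN f x. True) \<ge> \<epsilon>}
    \<le> ennreal (exp (\<theta> / \<eta> * (\<kappa> + \<eta> * L + R - sqrt (2 * \<eta> * N * \<epsilon>)) +
      N * (s\<^sup>2 * \<theta>\<^sup>2 / 2 + \<eta> / \<kappa> * excess_const TYPE('a) s L \<theta>)))"
proof -
  define l where "l = \<theta> / \<eta>"
  define r where "r = sqrt (2 * \<eta> * N * \<epsilon>) - \<eta> * L"
  define q where "q = N * (s\<^sup>2 * \<theta>\<^sup>2 / 2 + \<eta> / \<kappa> * excess_const TYPE('a) s L \<theta>)"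
  have "l > 0"
    using \<open>\<theta> > 0\<close> \<eta> by (simp add: l_def)
  interpret cond_subgaussian P "noise_history N" "\<lambda>e. e N" s
    by (rule cond_subgaussian_noise[OF P])
  have [measurable]: "Y N \<in> borel_measurable P"
    by (rule F_measurable_imp_M[OF measurable_sgd_potential[OF g_measurable]])
  have "{e \<in> space P. f (sgd_average x0 (\<lambda>_. \<eta>) N g e) - f (ARG_MIN f x. True) \<ge> \<epsilon>}
      \<subseteq> {e \<in> space P. 1 \<le> ennreal (exp (- l * r)) * ennreal (exp (l * Y N e))}"
  proof safe
    fix e assume "\<epsilon> \<le> f (sgd_average x0 (\<lambda>_. \<eta>) N g e) - f (ARG_MIN f x. True)"
    then have "\<epsilon> \<le> f (sgd_average x0 (\<lambda>_. \<eta>) N g e) - f xs"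
      using f(3)[of "ARG_MIN f x. True"] by linarith
    from sgd_potential_ge_of_average_gap[OF f(1,2) this \<open>\<epsilon> \<ge> 0\<close>]
    have "l * r \<le> l * Y N e"
      using \<open>l > 0\<close> by (intro mult_left_mono) (auto simp: r_def)
    then have "1 \<le> exp (- l * r + l * Y N e)"
      by simp
    then show "1 \<le> ennreal (exp (- l * r)) * ennreal (exp (l * Y N e))"
      by (simp add: ennreal_mult[symmetric] exp_add[symmetric] del: exp_minus)
  qed
  \<comment> \<open>Monotonicity of the measure asks for measurability of the larger event, which
    follows from that of \<open>Y N\<close>.\<close>
  then have "emeasure P {e \<in> space P. f (sgd_average x0 (\<lambda>_. \<eta>) N g e) - f (ARG_MIN f x. True) \<ge> \<epsilon>}
      \<le> emeasure P {e \<in> space P. 1 \<le> ennreal (exp (- l * r)) * ennreal (exp (l * Y N e))}"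
    by (intro emeasure_mono) measurable
  also have "\<dots> \<le> ennreal (exp (- l * r)) * (\<integral>\<^sup>+e. ennreal (exp (l * Y N e)) * indicator (space P) e \<partial>P)"
    by (rule nn_integral_Markov_inequality) measurable
  also have "(\<integral>\<^sup>+e. ennreal (exp (l * Y N e)) * indicator (space P) e \<partial>P)
      = (\<integral>\<^sup>+e. ennreal (exp (l * Y N e)) \<partial>P)"
    by (rule nn_integral_cong) simp
  also have "\<dots> \<le> ennreal (exp (l * (\<kappa> + norm (x0 - xs)) + q))"
    unfolding l_def q_def by (rule exp_moment_le[OF P \<open>\<theta> > 0\<close>])
  also have "\<dots> \<le> ennreal (exp (l * (\<kappa> + R) + q))"
    using R \<open>l > 0\<close> by (intro ennreal_leI) simp
  also have "ennreal (exp (- l * r)) * ennreal (exp (l * (\<kappa> + R) + q))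
      = ennreal (exp (l * (\<kappa> + \<eta> * L + R - sqrt (2 * \<eta> * N * \<epsilon>)) + q))"
    by (simp add: ennreal_mult[symmetric] exp_add[symmetric] r_def algebra_simps)
  finally show ?thesis
    by (simp add: l_def q_def mult_left_mono)
qed

end

section \<open>Worst-case probability, exponent and asymptotics\<close>

lemma worst_failure_prob_le:
  fixes x0 :: "'a::euclidean_space"
  assumes "\<kappa> > 0" "\<eta> > 0" "\<theta> > 0" "\<epsilon> \<ge> 0"
  shows "worst_failure_prob x0 R L s \<epsilon> (sgd_average x0 (\<lambda>_. \<eta>) N)
    \<le> ennreal (exp (\<theta> / \<eta> * (\<kappa> + \<eta> * L + R - sqrt (2 * \<eta> * N * \<epsilon>)) +
      N * (s\<^sup>2 * \<theta>\<^sup>2 / 2 + \<eta> / \<kappa> * excess_const TYPE('a) s L \<theta>)))"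
  unfolding worst_failure_prob_def
proof (intro SUP_least, clarify, intro SUP_least)
  fix f and g :: "'a \<Rightarrow> 'a" and P :: "(nat \<Rightarrow> 'a) measure"
  assume "(f, g) \<in> oracle_instances x0 R L" and P: "P \<in> admissible_laws s"
  then have f: "convex_on UNIV f" and g: "g \<in> borel_measurable borel" "\<And>x. g x \<in> subdifferential f x"
    "\<And>x. norm (g x) \<le> L"
    and "\<exists>xs. is_arg_min f (\<lambda>_. True) xs \<and> norm (x0 - xs) \<le> R"
    by (auto simp: oracle_instances_def objective_class_def)
  then obtain xs where xs: "\<And>x. f xs \<le> f x" "norm (x0 - xs) \<le> R"
    by (auto simp: is_arg_min_def not_less)
  \<comment> \<open>The subgradient inequality at \<open>x\<close>, tested at the minimizer, gives
    the sign condition that the potential relies on.\<close>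
  have "0 \<le> g x \<bullet> (x - xs)" for x
  proof -
    have "f xs \<ge> f x + g x \<bullet> (xs - x)"
      using g(2)[of x] by (auto simp: subdifferential_def)
    then show ?thesis
      using xs(1)[of x] by (simp add: inner_diff_right)
  qed
  then show "emeasure P {e \<in> space P. \<epsilon> \<le> f (sgd_average x0 (\<lambda>_. \<eta>) N g e) - f (ARG_MIN f x. True)}
    \<le> ennreal (exp (\<theta> / \<eta> * (\<kappa> + \<eta> * L + R - sqrt (2 * \<eta> * N * \<epsilon>)) +
      N * (s\<^sup>2 * \<theta>\<^sup>2 / 2 + \<eta> / \<kappa> * excess_const TYPE('a) s L \<theta>)))"
    using assms f g xs by (intro failure_prob_le P)
qed

lemma failure_exponent_ge:
  assumes "worst_failure_prob x0 R L s \<epsilon> A \<le> ennreal (exp (- E))"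
  shows "ereal E \<le> failure_exponent x0 R L s \<epsilon> A"
proof (cases "worst_failure_prob x0 R L s \<epsilon> A = 0")
  case True
  then show ?thesis
    by (simp add: failure_exponent_def)
next
  case False
  define p where "p = enn2real (worst_failure_prob x0 R L s \<epsilon> A)"
  \<comment> \<open>Finiteness matters because \<open>enn2real\<close> sends \<open>\<top>\<close>
    to 0, which would spoil the logarithm.\<close>
  have fin: "worst_failure_prob x0 R L s \<epsilon> A < \<top>"
    using assms by (rule le_less_trans) simp
  then have "p > 0"
    using False by (simp add: p_def enn2real_positive_iff zero_less_iff_neq_zero)
  have "p \<le> exp (- E)"
    unfolding p_def using assms by (intro enn2real_leI) auto
  then have "ln p \<le> - E"
    using \<open>p > 0\<close> ln_le_cancel_iff[of p "exp (- E)"] by simp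
  then show ?thesis
    using False by (simp add: failure_exponent_def p_def[symmetric])
qed

lemma worst_failure_prob_le_1: "worst_failure_prob x0 R L s \<epsilon> A \<le> 1"
  unfolding worst_failure_prob_def
  by (intro SUP_least, clarify, intro SUP_least prob_space.emeasure_le_1)
    (simp add: admissible_laws_def)

lemma smallo_1_sqrt_inverse:
  "(\<lambda>N. - (A * sqrt (1 / real N) + B * (1 / real N))) \<in> o(\<lambda>_. 1 :: real)"
proof (rule smalloI_tendsto)
  have "(\<lambda>N. - (A * sqrt (1 / real N) + B * (1 / real N))) \<longlonglongrightarrow> - (A * sqrt 0 + B * 0)"
    by (intro tendsto_intros lim_1_over_n)
  then show "(\<lambda>N. - (A * sqrt (1 / real N) + B * (1 / real N)) / 1) \<longlonglongrightarrow> 0"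
    by simp
qed simp

theorem corollary2:
  fixes x0 :: "real ^ 'd" and R L s \<epsilon> h :: real
  assumes "R > 0" and "L > 0" and "s > 0" and "0 < \<epsilon>" and "\<epsilon> < R * L" and "h > 0"
  shows "\<exists>\<delta> :: nat \<Rightarrow> real. \<delta> \<in> o(\<lambda>_. 1) \<and>
    (\<forall>\<^sub>F N in sequentially.
       failure_exponent x0 R L s \<epsilon> (sgd_average x0 (\<lambda>_. h * R\<^sup>2 / (\<epsilon> * real N)) N)
       \<ge> ereal ((max (sqrt (2 * h) - 1) 0)\<^sup>2 / h\<^sup>2 * (\<epsilon>\<^sup>2 * real N / (2 * R\<^sup>2 * s\<^sup>2)) * (1 + \<delta> N)))"
proof (cases "sqrt (2 * h) \<le> 1")
  case True
  \<comment> \<open>Here the claimed lower bound is 0, and exponents are nonnegative because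
    probabilities are at most 1.\<close>
  then have "max (sqrt (2 * h) - 1) 0 = 0"
    by simp
  moreover have "ereal 0 \<le> failure_exponent x0 R L s \<epsilon> A" for A
    by (rule failure_exponent_ge) (simp add: worst_failure_prob_le_1)
  ultimately show ?thesis
    by (intro exI[of _ "\<lambda>_. 0"]) (simp add: zero_ereal_def)
next
  case False
  define a where "a = sqrt (2 * h) - 1"
  \<comment> \<open>The minimizer of the leading exponent \<open>- (\<theta> / \<eta>) * a * R + N *
    s\<^sup>2 * \<theta>\<^sup>2 / 2\<close>; it does not depend on \<open>N\<close>. At this value
    the linear part is \<open>- 2 * c * N\<close> and the quadratic part \<open>c * N\<close>, with
    net rate \<open>c\<close>.\<close>
  define \<theta> where "\<theta> = a * \<epsilon> / (h * R * s\<^sup>2)"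
  define K where "K = excess_const TYPE(real ^ 'd) s L \<theta>"
  define c where "c = a\<^sup>2 / h\<^sup>2 * (\<epsilon>\<^sup>2 / (2 * R\<^sup>2 * s\<^sup>2))"
  \<comment> \<open>The coefficient of \<open>sqrt N\<close> in the error. The offset costs a term
    proportional to \<open>\<kappa> * N\<close> and the remainder one proportional to
    \<open>1 / \<kappa>\<close>; the choice \<open>\<kappa> = 1 / sqrt N\<close> balances
    them.\<close>
  define C where "C = \<theta> * \<epsilon> / (h * R\<^sup>2) + h * R\<^sup>2 * K / \<epsilon>"
  define \<delta> where "\<delta> N = - (C / c * sqrt (1 / real N) + \<theta> * L / c * (1 / real N))" for N
  have "a > 0"
    using False by (simp add: a_def)
  then have pos: "\<theta> > 0" "c > 0"
    using assms by (auto simp: \<theta>_def c_def)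
  have "failure_exponent x0 R L s \<epsilon> (sgd_average x0 (\<lambda>_. h * R\<^sup>2 / (\<epsilon> * real N)) N)
       \<ge> ereal ((max (sqrt (2 * h) - 1) 0)\<^sup>2 / h\<^sup>2 * (\<epsilon>\<^sup>2 * real N / (2 * R\<^sup>2 * s\<^sup>2)) * (1 + \<delta> N))"
    \<comment> \<open>At \<open>N = 0\<close> division by zero would make the step size 0, so the
      bound is asserted from 1 on.\<close>
    if "N \<ge> 1" for N :: nat
  proof (rule failure_exponent_ge)
    define \<eta> where "\<eta> = h * R\<^sup>2 / (\<epsilon> * real N)"
    define r where "r = sqrt (real N)"
    define \<kappa> where "\<kappa> = 1 / r"
    have "r > 0" and N: "real N = r\<^sup>2"
      using that by (auto simp: r_def)
    have "\<eta> > 0" "\<kappa> > 0"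
      using assms that \<open>r > 0\<close> by (auto simp: \<eta>_def \<kappa>_def)
    have "sqrt (2 * \<eta> * N * \<epsilon>) = sqrt (2 * h) * sqrt (R\<^sup>2)"
      unfolding real_sqrt_mult[symmetric] using assms that by (simp add: \<eta>_def)
    then have sq: "sqrt (2 * \<eta> * N * \<epsilon>) = (a + 1) * R"
      using assms by (simp add: a_def)
    have "\<theta> / \<eta> * (a * R) = 2 * c * N"
      using assms that by (simp add: \<theta>_def \<eta>_def c_def field_simps power2_eq_square)
    moreover have "N * (s\<^sup>2 * \<theta>\<^sup>2 / 2) = c * N"
      using assms by (simp add: \<theta>_def c_def field_simps power2_eq_square)
    moreover have "\<theta> / \<eta> * \<kappa> + N * (\<eta> / \<kappa> * K) = C * r"
      using assms \<open>r > 0\<close> by (simp add: C_def \<eta>_def \<kappa>_def N field_simps power2_eq_square)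
    moreover have "\<theta> / \<eta> * (\<eta> * L) = \<theta> * L"
      using \<open>\<eta> > 0\<close> by simp
    moreover have "t * (\<kappa> + \<eta> * L + R - (a + 1) * R) + N * (u + \<eta> / \<kappa> * K)
        = (t * \<kappa> + N * (\<eta> / \<kappa> * K)) + t * (\<eta> * L) - t * (a * R) + N * u" for t u :: real
      by (simp add: algebra_simps)
    note this[of "\<theta> / \<eta>" "s\<^sup>2 * \<theta>\<^sup>2 / 2"]
    ultimately have "\<theta> / \<eta> * (\<kappa> + \<eta> * L + R - sqrt (2 * \<eta> * N * \<epsilon>)) + N * (s\<^sup>2 * \<theta>\<^sup>2 / 2 + \<eta> / \<kappa> * K)
        = - (c * N - C * r - \<theta> * L)"
      unfolding sq by linarith
    also have "c * N - C * r - \<theta> * L = c * N * (1 + \<delta> N)"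
      using pos \<open>r > 0\<close> by (simp add: \<delta>_def N real_sqrt_divide field_simps power2_eq_square)
    also have "c * N = (max (sqrt (2 * h) - 1) 0)\<^sup>2 / h\<^sup>2 * (\<epsilon>\<^sup>2 * real N / (2 * R\<^sup>2 * s\<^sup>2))"
      using \<open>a > 0\<close> by (simp add: c_def a_def max_absorb1)
    finally show "worst_failure_prob x0 R L s \<epsilon> (sgd_average x0 (\<lambda>_. h * R\<^sup>2 / (\<epsilon> * real N)) N)
      \<le> ennreal (exp (- ((max (sqrt (2 * h) - 1) 0)\<^sup>2 / h\<^sup>2 * (\<epsilon>\<^sup>2 * real N / (2 * R\<^sup>2 * s\<^sup>2)) * (1 + \<delta> N))))"
      using worst_failure_prob_le[OF \<open>\<kappa> > 0\<close> \<open>\<eta> > 0\<close> \<open>\<theta> > 0\<close> less_imp_le[OF \<open>0 < \<epsilon>\<close>], of x0 R L s N]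
      by (simp only: K_def \<eta>_def)
  qed
  moreover have "\<delta> \<in> o(\<lambda>_. 1)"
    unfolding \<delta>_def[abs_def] by (rule smallo_1_sqrt_inverse)
  ultimately show ?thesis
    by (intro exI[of _ \<delta>] conjI eventually_sequentiallyI[of 1])
qed

end
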